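(* Algebras $H_1,H_2\in\Theta$ are LG-equivalent if and only if they are LG-isotypic.
   Context: Fix a variety $\Theta$, an infinite set of variables $X^0$, and let $\Gamma$ be the set of finite subsets of $X^0$; $W(X)$ is the free algebra of $\Theta$ over $X$. For $H\in\Theta$, $\mathrm{Hal}^X_\Theta(H)$ is the Boolean algebra of subsets of $\mathrm{Hom}(W(X),H)$ with quantifiers ($\mu\in\exists xA$ iff some $\nu\in A$ agrees with $\mu$ off $x$), equalities $[w\equiv w']_H=\{\mu:\mu(w)=\mu(w')\}$ and maps $s_*(A)=\{\mu:\mu\circ s\in A\}$ for homomorphisms $s:W(X)\to W(Y)$. The multi-sorted algebra of formulas $\Phi=(\Phi(X),X\in\Gamma)$ is the free Halmos algebra (multi-sorted algebras with sorts extended Boolean algebras with quantifiers $\exists x$, equalities $w\equiv w'$, and operations $s_*$, satisfying the Halmos axioms) over the sets of formal equalities $w\equiv w'$, $w,w'\in W(X)$; $\mathrm{Val}^X_H:\Phi(X)\to\mathrm{Hal}^X_\Theta(H)$ are the components of the unique homomorphism sending $w\equiv w'$ to $[w\equiv w']_H$. A point $\mu:W(X)\to H$ satisfies $u$ iff $\mu\in\mathrm{Val}^X_H(u)$; the logical kernel $\mathrm{LKer}(\mu)$ is the set of formulas in $\Phi(X)$ satisfied by $\mu$. For $T\subseteq\Phi(X)$, $T^L_H=\{\mu:T\subseteq\mathrm{LKer}(\mu)\}$, for $A\subseteq\mathrm{Hom}(W(X),H)$, $A^L_H=\bigcap_{\mu\in A}\mathrm{LKer}(\mu)$, $T^{LL}_H=(T^L_H)^L_H$.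 $H_1,H_2$ are LG-equivalent iff $T^{LL}_{H_1}=T^{LL}_{H_2}$ for all $X\in\Gamma$, $T\subseteq\Phi(X)$. $H_1,H_2$ are LG-isotypic iff for every $X\in\Gamma$, for every point $\mu:W(X)\to H_1$ there is a point $\nu:W(X)\to H_2$ with $\mathrm{LKer}(\mu)=\mathrm{LKer}(\nu)$, and conversely for every $\nu:W(X)\to H_2$ there is $\mu:W(X)\to H_1$ with $\mathrm{LKer}(\nu)=\mathrm{LKer}(\mu)$. *)

theory Defs
  imports Main "HOL-Library.FuncSet"
begin

section \<open>Varieties of algebras\<close>

text \<open>The infinite set of variables is the universe of the type \<open>'x\<close>, and a variety is presented by
  a signature together with a set of identities in these variables.\<close>

datatype ('f, 'x) trm = Var 'x | Fun 'f "('f, 'x) trm list"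

record ('f, 'x) presentation =
  arity :: "'f \<Rightarrow> nat"
  idents :: "(('f, 'x) trm \<times> ('f, 'x) trm) set"

inductive_set terms :: "('f, 'x) presentation \<Rightarrow> 'x set \<Rightarrow> ('f, 'x) trm set"
  for \<Theta> X where
  "x \<in> X \<Longrightarrow> Var x \<in> terms \<Theta> X"
| "length ts = arity \<Theta> f \<Longrightarrow> (\<And>t. t \<in> set ts \<Longrightarrow> t \<in> terms \<Theta> X) \<Longrightarrow> Fun f ts \<in> terms \<Theta> X"

definition presents_variety :: "('f, 'x) presentation \<Rightarrow> bool" where
  "presents_variety \<Theta> \<longleftrightarrow> idents \<Theta> \<subseteq> terms \<Theta> UNIV \<times> terms \<Theta> UNIV"

record ('f, 'a) alg =
  carrier :: "'a set"
  oper :: "'f \<Rightarrow> 'a list \<Rightarrow> 'a"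

primrec eval :: "('f, 'a) alg \<Rightarrow> ('x \<Rightarrow> 'a) \<Rightarrow> ('f, 'x) trm \<Rightarrow> 'a" where
  "eval A \<sigma> (Var x) = \<sigma> x"
| "eval A \<sigma> (Fun f ts) = oper A f (map (eval A \<sigma>) ts)"

definition is_alg :: "('f, 'x) presentation \<Rightarrow> ('f, 'a) alg \<Rightarrow> bool" where
  "is_alg \<Theta> A \<longleftrightarrow>
     (\<forall>f as. length as = arity \<Theta> f \<longrightarrow> set as \<subseteq> carrier A \<longrightarrow> oper A f as \<in> carrier A)"

definition in_variety :: "('f, 'a) alg \<Rightarrow> ('f, 'x) presentation \<Rightarrow> bool" where
  "in_variety A \<Theta> \<longleftrightarrow> is_alg \<Theta> A \<and>
     (\<forall>(l, r) \<in> idents \<Theta>. \<forall>\<sigma>. range \<sigma> \<subseteq> carrier A \<longrightarrow> eval A \<sigma> l = eval A \<sigma> r)"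

definition alg_hom ::
  "('f, 'x) presentation \<Rightarrow> ('f, 'a) alg \<Rightarrow> ('f, 'b) alg \<Rightarrow> ('a \<Rightarrow> 'b) set" where
  "alg_hom \<Theta> A B = {h \<in> carrier A \<rightarrow>\<^sub>E carrier B.
     \<forall>f as. length as = arity \<Theta> f \<longrightarrow> set as \<subseteq> carrier A \<longrightarrow>
       h (oper A f as) = oper B f (map h as)}"

definition term_alg :: "('f, 'x) presentation \<Rightarrow> 'x set \<Rightarrow> ('f, ('f, 'x) trm) alg" where
  "term_alg \<Theta> X = \<lparr>carrier = terms \<Theta> X, oper = Fun\<rparr>"

text \<open>The congruence of the term algebra over \<open>X\<close> generated by all instances of the identities.\<close>

inductive term_eq :: "('f, 'x) presentation \<Rightarrow> 'x set \<Rightarrow> ('f, 'x) trm \<Rightarrow> ('f, 'x) trm \<Rightarrow> bool"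
  for \<Theta> X where
  term_ident: "(l, r) \<in> idents \<Theta> \<Longrightarrow> range \<sigma> \<subseteq> terms \<Theta> X \<Longrightarrow>
    term_eq \<Theta> X (eval (term_alg \<Theta> X) \<sigma> l) (eval (term_alg \<Theta> X) \<sigma> r)"
| term_refl: "t \<in> terms \<Theta> X \<Longrightarrow> term_eq \<Theta> X t t"
| term_sym: "term_eq \<Theta> X s t \<Longrightarrow> term_eq \<Theta> X t s"
| term_trans: "term_eq \<Theta> X s t \<Longrightarrow> term_eq \<Theta> X t u \<Longrightarrow> term_eq \<Theta> X s u"
| term_cong: "length ss = arity \<Theta> f \<Longrightarrow> list_all2 (term_eq \<Theta> X) ss ts \<Longrightarrow>
    term_eq \<Theta> X (Fun f ss) (Fun f ts)"

type_synonym ('f, 'x) word = "('f, 'x) trm set"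

definition word_of :: "('f, 'x) presentation \<Rightarrow> 'x set \<Rightarrow> ('f, 'x) trm \<Rightarrow> ('f, 'x) word" where
  "word_of \<Theta> X t = {(s, t). term_eq \<Theta> X s t} `` {t}"

text \<open>The free algebra \<open>W(X)\<close> of the variety. It is empty if \<open>X\<close> is empty and there are no constants.\<close>

definition W :: "('f, 'x) presentation \<Rightarrow> 'x set \<Rightarrow> ('f, ('f, 'x) word) alg" where
  "W \<Theta> X = \<lparr>carrier = terms \<Theta> X // {(s, t). term_eq \<Theta> X s t},
     oper = (\<lambda>f ws. word_of \<Theta> X (Fun f (map (\<lambda>w. SOME t. t \<in> w) ws)))\<rparr>"

definition var :: "('f, 'x) presentation \<Rightarrow> 'x set \<Rightarrow> 'x \<Rightarrow> ('f, 'x) word" where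
  "var \<Theta> X x = word_of \<Theta> X (Var x)"

text \<open>\<open>y\<close> is not in the support of \<open>w\<close> if \<open>w\<close> can be written without \<open>y\<close>.\<close>

definition avoids :: "('f, 'x) presentation \<Rightarrow> 'x set \<Rightarrow> 'x \<Rightarrow> ('f, 'x) word \<Rightarrow> bool" where
  "avoids \<Theta> X y w \<longleftrightarrow> (\<exists>t \<in> w. t \<in> terms \<Theta> (X - {y}))"


section \<open>Halmos algebras\<close>

text \<open>Sorts are indexed by the finite sets of variables; the values of the fields at infinite sets
  are irrelevant throughout. The operation \<open>subst X Y s\<close> is \<open>s\<^sub>*\<close> for \<open>s : W(X) \<rightarrow> W(Y)\<close>.\<close>

record ('f, 'x, 'b) msalg =
  sorts :: "'x set \<Rightarrow> 'b set"
  meet :: "'x set \<Rightarrow> 'b \<Rightarrow> 'b \<Rightarrow> 'b"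
  join :: "'x set \<Rightarrow> 'b \<Rightarrow> 'b \<Rightarrow> 'b"
  neg :: "'x set \<Rightarrow> 'b \<Rightarrow> 'b"
  zero :: "'x set \<Rightarrow> 'b"
  one :: "'x set \<Rightarrow> 'b"
  exi :: "'x set \<Rightarrow> 'x \<Rightarrow> 'b \<Rightarrow> 'b"
  equ :: "'x set \<Rightarrow> ('f, 'x) word \<Rightarrow> ('f, 'x) word \<Rightarrow> 'b"
  subst :: "'x set \<Rightarrow> 'x set \<Rightarrow> (('f, 'x) word \<Rightarrow> ('f, 'x) word) \<Rightarrow> 'b \<Rightarrow> 'b"

definition is_msalg :: "('f, 'x) presentation \<Rightarrow> ('f, 'x, 'b) msalg \<Rightarrow> bool" where
  "is_msalg \<Theta> A \<longleftrightarrow> (\<forall>X. finite X \<longrightarrow>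
     (\<forall>a \<in> sorts A X. \<forall>b \<in> sorts A X. meet A X a b \<in> sorts A X \<and> join A X a b \<in> sorts A X) \<and>
     (\<forall>a \<in> sorts A X. neg A X a \<in> sorts A X) \<and>
     zero A X \<in> sorts A X \<and> one A X \<in> sorts A X \<and>
     (\<forall>x \<in> X. \<forall>a \<in> sorts A X. exi A X x a \<in> sorts A X) \<and>
     (\<forall>w \<in> carrier (W \<Theta> X). \<forall>w' \<in> carrier (W \<Theta> X). equ A X w w' \<in> sorts A X) \<and>
     (\<forall>Y. finite Y \<longrightarrow> (\<forall>s \<in> alg_hom \<Theta> (W \<Theta> X) (W \<Theta> Y). \<forall>a \<in> sorts A X.
        subst A X Y s a \<in> sorts A Y)))"

text \<open>\<open>halmos_axiom \<Theta> A X a b\<close>: the equation \<open>a = b\<close> in sort \<open>X\<close> is an instance in \<open>A\<close> of one of the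
  axioms of Halmos algebras; an axiom of the form \<open>a \<le> b\<close> is read as \<open>a \<and> b = a\<close>. Stated as a relation
  on an arbitrary multi-sorted algebra, the axioms serve both to define Halmos algebras and to
  generate the congruence that defines the free one.\<close>

inductive halmos_axiom ::
  "('f, 'x) presentation \<Rightarrow> ('f, 'x, 'b) msalg \<Rightarrow> 'x set \<Rightarrow> 'b \<Rightarrow> 'b \<Rightarrow> bool"
  for \<Theta> A where
  \<comment> \<open>Boolean algebra\<close>
  meet_assoc: "\<lbrakk>finite X; a \<in> sorts A X; b \<in> sorts A X; c \<in> sorts A X\<rbrakk> \<Longrightarrow>
    halmos_axiom \<Theta> A X (meet A X (meet A X a b) c) (meet A X a (meet A X b c))"
| join_assoc: "\<lbrakk>finite X; a \<in> sorts A X; b \<in> sorts A X; c \<in> sorts A X\<rbrakk> \<Longrightarrow>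
    halmos_axiom \<Theta> A X (join A X (join A X a b) c) (join A X a (join A X b c))"
| meet_commute: "\<lbrakk>finite X; a \<in> sorts A X; b \<in> sorts A X\<rbrakk> \<Longrightarrow>
    halmos_axiom \<Theta> A X (meet A X a b) (meet A X b a)"
| join_commute: "\<lbrakk>finite X; a \<in> sorts A X; b \<in> sorts A X\<rbrakk> \<Longrightarrow>
    halmos_axiom \<Theta> A X (join A X a b) (join A X b a)"
| meet_join_distrib: "\<lbrakk>finite X; a \<in> sorts A X; b \<in> sorts A X; c \<in> sorts A X\<rbrakk> \<Longrightarrow>
    halmos_axiom \<Theta> A X (meet A X a (join A X b c)) (join A X (meet A X a b) (meet A X a c))"
| join_meet_distrib: "\<lbrakk>finite X; a \<in> sorts A X; b \<in> sorts A X; c \<in> sorts A X\<rbrakk> \<Longrightarrow>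
    halmos_axiom \<Theta> A X (join A X a (meet A X b c)) (meet A X (join A X a b) (join A X a c))"
| meet_one: "\<lbrakk>finite X; a \<in> sorts A X\<rbrakk> \<Longrightarrow> halmos_axiom \<Theta> A X (meet A X a (one A X)) a"
| join_zero: "\<lbrakk>finite X; a \<in> sorts A X\<rbrakk> \<Longrightarrow> halmos_axiom \<Theta> A X (join A X a (zero A X)) a"
| meet_neg: "\<lbrakk>finite X; a \<in> sorts A X\<rbrakk> \<Longrightarrow> halmos_axiom \<Theta> A X (meet A X a (neg A X a)) (zero A X)"
| join_neg: "\<lbrakk>finite X; a \<in> sorts A X\<rbrakk> \<Longrightarrow> halmos_axiom \<Theta> A X (join A X a (neg A X a)) (one A X)"
  \<comment> \<open>existential quantifiers\<close>
| exi_zero: "\<lbrakk>finite X; x \<in> X\<rbrakk> \<Longrightarrow> halmos_axiom \<Theta> A X (exi A X x (zero A X)) (zero A X)"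
| exi_ge: "\<lbrakk>finite X; x \<in> X; a \<in> sorts A X\<rbrakk> \<Longrightarrow>
    halmos_axiom \<Theta> A X (meet A X a (exi A X x a)) a"
| exi_meet: "\<lbrakk>finite X; x \<in> X; a \<in> sorts A X; b \<in> sorts A X\<rbrakk> \<Longrightarrow>
    halmos_axiom \<Theta> A X (exi A X x (meet A X a (exi A X x b))) (meet A X (exi A X x a) (exi A X x b))"
| exi_commute: "\<lbrakk>finite X; x \<in> X; y \<in> X; a \<in> sorts A X\<rbrakk> \<Longrightarrow>
    halmos_axiom \<Theta> A X (exi A X x (exi A X y a)) (exi A X y (exi A X x a))"
  \<comment> \<open>equalities; the second axiom is
    \<open>w\<^sub>1 \<equiv> w\<^sub>1' \<and> \<dots> \<and> w\<^sub>n \<equiv> w\<^sub>n' \<le> f(w\<^sub>1,\<dots>,w\<^sub>n) \<equiv> f(w\<^sub>1',\<dots>,w\<^sub>n')\<close>\<close>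
| equ_refl: "\<lbrakk>finite X; w \<in> carrier (W \<Theta> X)\<rbrakk> \<Longrightarrow> halmos_axiom \<Theta> A X (equ A X w w) (one A X)"
| equ_oper: "\<lbrakk>finite X; length ws = arity \<Theta> f; length ws' = arity \<Theta> f;
      set ws \<subseteq> carrier (W \<Theta> X); set ws' \<subseteq> carrier (W \<Theta> X);
      p = foldr (meet A X) (map2 (equ A X) ws ws') (one A X)\<rbrakk> \<Longrightarrow>
    halmos_axiom \<Theta> A X (meet A X p (equ A X (oper (W \<Theta> X) f ws) (oper (W \<Theta> X) f ws'))) p"
  \<comment> \<open>\<open>s\<^sub>*\<close> is a homomorphism of Boolean algebras\<close>
| subst_meet: "\<lbrakk>finite X; finite Y; s \<in> alg_hom \<Theta> (W \<Theta> X) (W \<Theta> Y); a \<in> sorts A X; b \<in> sorts A X\<rbrakk> \<Longrightarrow>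
    halmos_axiom \<Theta> A Y (subst A X Y s (meet A X a b)) (meet A Y (subst A X Y s a) (subst A X Y s b))"
| subst_join: "\<lbrakk>finite X; finite Y; s \<in> alg_hom \<Theta> (W \<Theta> X) (W \<Theta> Y); a \<in> sorts A X; b \<in> sorts A X\<rbrakk> \<Longrightarrow>
    halmos_axiom \<Theta> A Y (subst A X Y s (join A X a b)) (join A Y (subst A X Y s a) (subst A X Y s b))"
| subst_neg: "\<lbrakk>finite X; finite Y; s \<in> alg_hom \<Theta> (W \<Theta> X) (W \<Theta> Y); a \<in> sorts A X\<rbrakk> \<Longrightarrow>
    halmos_axiom \<Theta> A Y (subst A X Y s (neg A X a)) (neg A Y (subst A X Y s a))"
| subst_zero: "\<lbrakk>finite X; finite Y; s \<in> alg_hom \<Theta> (W \<Theta> X) (W \<Theta> Y)\<rbrakk> \<Longrightarrow>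
    halmos_axiom \<Theta> A Y (subst A X Y s (zero A X)) (zero A Y)"
| subst_one: "\<lbrakk>finite X; finite Y; s \<in> alg_hom \<Theta> (W \<Theta> X) (W \<Theta> Y)\<rbrakk> \<Longrightarrow>
    halmos_axiom \<Theta> A Y (subst A X Y s (one A X)) (one A Y)"
  \<comment> \<open>functoriality\<close>
| subst_id: "\<lbrakk>finite X; a \<in> sorts A X\<rbrakk> \<Longrightarrow>
    halmos_axiom \<Theta> A X (subst A X X (\<lambda>w \<in> carrier (W \<Theta> X). w) a) a"
| subst_comp: "\<lbrakk>finite X; finite Y; finite Z; s \<in> alg_hom \<Theta> (W \<Theta> X) (W \<Theta> Y);
      s' \<in> alg_hom \<Theta> (W \<Theta> Y) (W \<Theta> Z); a \<in> sorts A X\<rbrakk> \<Longrightarrow>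
    halmos_axiom \<Theta> A Z (subst A Y Z s' (subst A X Y s a)) (subst A X Z (compose (carrier (W \<Theta> X)) s' s) a)"
  \<comment> \<open>\<open>s\<^sub>*\<close> and quantifiers\<close>
| subst_exi_irrelevant: "\<lbrakk>finite X; finite Y; x \<in> X; a \<in> sorts A X;
      s \<in> alg_hom \<Theta> (W \<Theta> X) (W \<Theta> Y); s' \<in> alg_hom \<Theta> (W \<Theta> X) (W \<Theta> Y);
      \<forall>z \<in> X - {x}. s (var \<Theta> X z) = s' (var \<Theta> X z)\<rbrakk> \<Longrightarrow>
    halmos_axiom \<Theta> A Y (subst A X Y s (exi A X x a)) (subst A X Y s' (exi A X x a))"
| subst_exi: "\<lbrakk>finite X; finite Y; x \<in> X; y \<in> Y; a \<in> sorts A X; s \<in> alg_hom \<Theta> (W \<Theta> X) (W \<Theta> Y);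
      s (var \<Theta> X x) = var \<Theta> Y y; \<forall>z \<in> X - {x}. avoids \<Theta> Y y (s (var \<Theta> X z))\<rbrakk> \<Longrightarrow>
    halmos_axiom \<Theta> A Y (subst A X Y s (exi A X x a)) (exi A Y y (subst A X Y s a))"
  \<comment> \<open>\<open>s\<^sub>*\<close> and equalities; in the second axiom \<open>s\<close> and \<open>s'\<close> replace \<open>x\<close> by \<open>w\<close> and \<open>w'\<close>:
    \<open>s\<^sub>*a \<and> (w \<equiv> w') \<le> s'\<^sub>*a\<close>\<close>
| subst_equ: "\<lbrakk>finite X; finite Y; s \<in> alg_hom \<Theta> (W \<Theta> X) (W \<Theta> Y);
      w \<in> carrier (W \<Theta> X); w' \<in> carrier (W \<Theta> X)\<rbrakk> \<Longrightarrow>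
    halmos_axiom \<Theta> A Y (subst A X Y s (equ A X w w')) (equ A Y (s w) (s w'))"
| equ_replace: "\<lbrakk>finite X; x \<in> X; a \<in> sorts A X; w \<in> carrier (W \<Theta> X); w' \<in> carrier (W \<Theta> X);
      s \<in> alg_hom \<Theta> (W \<Theta> X) (W \<Theta> X); s' \<in> alg_hom \<Theta> (W \<Theta> X) (W \<Theta> X);
      s (var \<Theta> X x) = w; s' (var \<Theta> X x) = w';
      \<forall>z \<in> X - {x}. s (var \<Theta> X z) = var \<Theta> X z \<and> s' (var \<Theta> X z) = var \<Theta> X z;
      p = meet A X (subst A X X s a) (equ A X w w')\<rbrakk> \<Longrightarrow>
    halmos_axiom \<Theta> A X (meet A X p (subst A X X s' a)) p"

definition is_halmos :: "('f, 'x) presentation \<Rightarrow> ('f, 'x, 'b) msalg \<Rightarrow> bool" where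
  "is_halmos \<Theta> A \<longleftrightarrow> is_msalg \<Theta> A \<and> (\<forall>X a b. halmos_axiom \<Theta> A X a b \<longrightarrow> a = b)"

definition msalg_hom :: "('f, 'x) presentation \<Rightarrow> ('f, 'x, 'b) msalg \<Rightarrow> ('f, 'x, 'c) msalg \<Rightarrow>
    ('x set \<Rightarrow> 'b \<Rightarrow> 'c) set" where
  "msalg_hom \<Theta> A B = {h \<in> (\<Pi>\<^sub>E X \<in> {X. finite X}. sorts A X \<rightarrow>\<^sub>E sorts B X). \<forall>X. finite X \<longrightarrow>
     (\<forall>a \<in> sorts A X. \<forall>b \<in> sorts A X. h X (meet A X a b) = meet B X (h X a) (h X b) \<and>
        h X (join A X a b) = join B X (h X a) (h X b)) \<and>
     (\<forall>a \<in> sorts A X. h X (neg A X a) = neg B X (h X a)) \<and>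
     h X (zero A X) = zero B X \<and> h X (one A X) = one B X \<and>
     (\<forall>x \<in> X. \<forall>a \<in> sorts A X. h X (exi A X x a) = exi B X x (h X a)) \<and>
     (\<forall>w \<in> carrier (W \<Theta> X). \<forall>w' \<in> carrier (W \<Theta> X). h X (equ A X w w') = equ B X w w') \<and>
     (\<forall>Y. finite Y \<longrightarrow> (\<forall>s \<in> alg_hom \<Theta> (W \<Theta> X) (W \<Theta> Y). \<forall>a \<in> sorts A X.
        h Y (subst A X Y s a) = subst B X Y s (h X a)))}"


section \<open>The algebra of formulas\<close>

datatype ('f, 'x) form =
    Equ "('f, 'x) word" "('f, 'x) word"
  | Zero
  | One
  | Neg "('f, 'x) form"
  | Conj "('f, 'x) form" "('f, 'x) form"
  | Disj "('f, 'x) form" "('f, 'x) form"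
  | Exi 'x "('f, 'x) form"
  | Subst "'x set" "('f, 'x) word \<Rightarrow> ('f, 'x) word" "('f, 'x) form"

inductive is_form :: "('f, 'x) presentation \<Rightarrow> 'x set \<Rightarrow> ('f, 'x) form \<Rightarrow> bool" for \<Theta> where
  "w \<in> carrier (W \<Theta> X) \<Longrightarrow> w' \<in> carrier (W \<Theta> X) \<Longrightarrow> is_form \<Theta> X (Equ w w')"
| "is_form \<Theta> X Zero"
| "is_form \<Theta> X One"
| "is_form \<Theta> X u \<Longrightarrow> is_form \<Theta> X (Neg u)"
| "is_form \<Theta> X u \<Longrightarrow> is_form \<Theta> X v \<Longrightarrow> is_form \<Theta> X (Conj u v)"
| "is_form \<Theta> X u \<Longrightarrow> is_form \<Theta> X v \<Longrightarrow> is_form \<Theta> X (Disj u v)"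
| "x \<in> X \<Longrightarrow> is_form \<Theta> X u \<Longrightarrow> is_form \<Theta> X (Exi x u)"
| "finite X \<Longrightarrow> s \<in> alg_hom \<Theta> (W \<Theta> X) (W \<Theta> Y) \<Longrightarrow> is_form \<Theta> X u \<Longrightarrow>
    is_form \<Theta> Y (Subst X s u)"

text \<open>The absolutely free multi-sorted algebra over the formal equalities. The generators \<open>w \<equiv> w'\<close> are
  at the same time the equality constants of the signature.\<close>

definition form_alg :: "('f, 'x) presentation \<Rightarrow> ('f, 'x, ('f, 'x) form) msalg" where
  "form_alg \<Theta> = \<lparr>sorts = (\<lambda>X. {u. is_form \<Theta> X u}), meet = (\<lambda>X. Conj), join = (\<lambda>X. Disj),
     neg = (\<lambda>X. Neg), zero = (\<lambda>X. Zero), one = (\<lambda>X. One), exi = (\<lambda>X. Exi), equ = (\<lambda>X. Equ),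
     subst = (\<lambda>X Y. Subst X)\<rparr>"

text \<open>The congruence of \<open>form_alg\<close> generated by all instances of the Halmos axioms.\<close>

inductive form_eq ::
  "('f, 'x) presentation \<Rightarrow> 'x set \<Rightarrow> ('f, 'x) form \<Rightarrow> ('f, 'x) form \<Rightarrow> bool" for \<Theta> where
  form_axiom: "halmos_axiom \<Theta> (form_alg \<Theta>) X u v \<Longrightarrow> form_eq \<Theta> X u v"
| form_refl: "is_form \<Theta> X u \<Longrightarrow> form_eq \<Theta> X u u"
| form_sym: "form_eq \<Theta> X u v \<Longrightarrow> form_eq \<Theta> X v u"
| form_trans: "form_eq \<Theta> X u v \<Longrightarrow> form_eq \<Theta> X v w \<Longrightarrow> form_eq \<Theta> X u w"
| form_neg: "form_eq \<Theta> X u v \<Longrightarrow> form_eq \<Theta> X (Neg u) (Neg v)"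
| form_conj: "form_eq \<Theta> X u v \<Longrightarrow> form_eq \<Theta> X u' v' \<Longrightarrow> form_eq \<Theta> X (Conj u u') (Conj v v')"
| form_disj: "form_eq \<Theta> X u v \<Longrightarrow> form_eq \<Theta> X u' v' \<Longrightarrow> form_eq \<Theta> X (Disj u u') (Disj v v')"
| form_exi: "x \<in> X \<Longrightarrow> form_eq \<Theta> X u v \<Longrightarrow> form_eq \<Theta> X (Exi x u) (Exi x v)"
| form_subst: "finite X \<Longrightarrow> s \<in> alg_hom \<Theta> (W \<Theta> X) (W \<Theta> Y) \<Longrightarrow> form_eq \<Theta> X u v \<Longrightarrow>
    form_eq \<Theta> Y (Subst X s u) (Subst X s v)"

type_synonym ('f, 'x) formula = "('f, 'x) form set"

definition formula_of ::
  "('f, 'x) presentation \<Rightarrow> 'x set \<Rightarrow> ('f, 'x) form \<Rightarrow> ('f, 'x) formula" where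
  "formula_of \<Theta> X u = {(u, v). form_eq \<Theta> X u v} `` {u}"

text \<open>The algebra of formulas: the free Halmos algebra over the formal equalities.\<close>

definition Phi :: "('f, 'x) presentation \<Rightarrow> ('f, 'x, ('f, 'x) formula) msalg" where
  "Phi \<Theta> = (let F = form_alg \<Theta>; cls = formula_of \<Theta>; rep = (\<lambda>U. SOME u. u \<in> U) in
     \<lparr>sorts = (\<lambda>X. sorts F X // {(u, v). form_eq \<Theta> X u v}),
      meet = (\<lambda>X U V. cls X (meet F X (rep U) (rep V))),
      join = (\<lambda>X U V. cls X (join F X (rep U) (rep V))),
      neg = (\<lambda>X U. cls X (neg F X (rep U))),
      zero = (\<lambda>X. cls X (zero F X)),
      one = (\<lambda>X. cls X (one F X)),
      exi = (\<lambda>X x U. cls X (exi F X x (rep U))),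
      equ = (\<lambda>X w w'. cls X (equ F X w w')),
      subst = (\<lambda>X Y s U. cls Y (subst F X Y s (rep U)))\<rparr>)"


section \<open>Values of formulas and logical kernels\<close>

definition points ::
  "('f, 'x) presentation \<Rightarrow> ('f, 'a) alg \<Rightarrow> 'x set \<Rightarrow> (('f, 'x) word \<Rightarrow> 'a) set" where
  "points \<Theta> H X = alg_hom \<Theta> (W \<Theta> X) H"

definition Hal ::
  "('f, 'x) presentation \<Rightarrow> ('f, 'a) alg \<Rightarrow> ('f, 'x, (('f, 'x) word \<Rightarrow> 'a) set) msalg" where
  "Hal \<Theta> H =
     \<lparr>sorts = (\<lambda>X. Pow (points \<Theta> H X)),
      meet = (\<lambda>X A B. A \<inter> B),
      join = (\<lambda>X A B. A \<union> B),
      neg = (\<lambda>X A. points \<Theta> H X - A),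
      zero = (\<lambda>X. {}),
      one = (\<lambda>X. points \<Theta> H X),
      exi = (\<lambda>X x A. {\<mu> \<in> points \<Theta> H X.
        \<exists>\<nu> \<in> A. \<forall>z \<in> X - {x}. \<mu> (var \<Theta> X z) = \<nu> (var \<Theta> X z)}),
      equ = (\<lambda>X w w'. {\<mu> \<in> points \<Theta> H X. \<mu> w = \<mu> w'}),
      subst = (\<lambda>X Y s A. {\<mu> \<in> points \<Theta> H Y. compose (carrier (W \<Theta> X)) \<mu> s \<in> A})\<rparr>"

definition Val :: "('f, 'x) presentation \<Rightarrow> ('f, 'a) alg \<Rightarrow> 'x set \<Rightarrow>
    ('f, 'x) formula \<Rightarrow> (('f, 'x) word \<Rightarrow> 'a) set" where
  "Val \<Theta> H = (THE h. h \<in> msalg_hom \<Theta> (Phi \<Theta>) (Hal \<Theta> H))"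

definition LKer :: "('f, 'x) presentation \<Rightarrow> ('f, 'a) alg \<Rightarrow> 'x set \<Rightarrow>
    (('f, 'x) word \<Rightarrow> 'a) \<Rightarrow> ('f, 'x) formula set" where
  "LKer \<Theta> H X \<mu> = {u \<in> sorts (Phi \<Theta>) X. \<mu> \<in> Val \<Theta> H X u}"

text \<open>The Galois correspondence \<open>T \<mapsto> T\<^sup>L\<close>, \<open>A \<mapsto> A\<^sup>L\<close>; the empty intersection is \<open>\<Phi>(X)\<close>.\<close>

definition points_of :: "('f, 'x) presentation \<Rightarrow> ('f, 'a) alg \<Rightarrow> 'x set \<Rightarrow>
    ('f, 'x) formula set \<Rightarrow> (('f, 'x) word \<Rightarrow> 'a) set" where
  "points_of \<Theta> H X T = {\<mu> \<in> points \<Theta> H X. T \<subseteq> LKer \<Theta> H X \<mu>}"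

definition theory_of :: "('f, 'x) presentation \<Rightarrow> ('f, 'a) alg \<Rightarrow> 'x set \<Rightarrow>
    (('f, 'x) word \<Rightarrow> 'a) set \<Rightarrow> ('f, 'x) formula set" where
  "theory_of \<Theta> H X A = sorts (Phi \<Theta>) X \<inter> (\<Inter>\<mu> \<in> A. LKer \<Theta> H X \<mu>)"

definition LG_equivalent ::
  "('f, 'x) presentation \<Rightarrow> ('f, 'a) alg \<Rightarrow> ('f, 'b) alg \<Rightarrow> bool" where
  "LG_equivalent \<Theta> H1 H2 \<longleftrightarrow> (\<forall>X T. finite X \<longrightarrow> T \<subseteq> sorts (Phi \<Theta>) X \<longrightarrow>
     theory_of \<Theta> H1 X (points_of \<Theta> H1 X T) = theory_of \<Theta> H2 X (points_of \<Theta> H2 X T))"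

definition LG_isotypic ::
  "('f, 'x) presentation \<Rightarrow> ('f, 'a) alg \<Rightarrow> ('f, 'b) alg \<Rightarrow> bool" where
  "LG_isotypic \<Theta> H1 H2 \<longleftrightarrow> (\<forall>X. finite X \<longrightarrow>
     (\<forall>\<mu> \<in> points \<Theta> H1 X. \<exists>\<nu> \<in> points \<Theta> H2 X. LKer \<Theta> H1 X \<mu> = LKer \<Theta> H2 X \<nu>) \<and>
     (\<forall>\<nu> \<in> points \<Theta> H2 X. \<exists>\<mu> \<in> points \<Theta> H1 X. LKer \<Theta> H2 X \<nu> = LKer \<Theta> H1 X \<mu>))"

end

theory Submission
  imports Defs
begin

text \<open>The closure \<open>T\<^sup>L\<^sup>L\<close> depends only on the set of logical kernels of points, so isotypic algebras
  are equivalent. Conversely, a logical kernel \<open>T = LKer \<mu>\<close> over \<open>H\<^sub>1\<close> is closed, hence also closed over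
  \<open>H\<^sub>2\<close>; as \<open>T \<noteq> \<Phi>(X)\<close>, some point \<open>\<nu>\<close> over \<open>H\<^sub>2\<close> has \<open>T \<subseteq> LKer \<nu>\<close>. Both are ultrafilters because
  \<open>Val\<close> respects negation, hence they coincide. That \<open>Val\<close> is a homomorphism at all amounts to
  \<open>Hal\<close> satisfying the Halmos axioms, where freeness of \<open>W(X)\<close> provides the points that are needed for
  commuting quantifiers and for moving a quantifier across \<open>s\<^sub>*\<close>.\<close>

section \<open>The free algebra of the variety\<close>

lemma terms_mono: "t \<in> terms \<Theta> X \<Longrightarrow> X \<subseteq> Y \<Longrightarrow> t \<in> terms \<Theta> Y"
  by (induction rule: terms.induct) (auto intro: terms.intros)

lemma eval_cong:
  assumes "t \<in> terms \<Theta> X" and "\<And>x. x \<in> X \<Longrightarrow> \<sigma> x = \<tau> x"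
  shows "eval A \<sigma> t = eval A \<tau> t"
  using assms(1)
proof induction
  case (2 ts f)
  then have "map (eval A \<sigma>) ts = map (eval A \<tau>) ts" by simp
  then show ?case by (simp only: eval.simps)
qed (simp add: assms(2))

lemma eval_in_carrier:
  assumes "t \<in> terms \<Theta> X" and "is_alg \<Theta> A" and "\<And>x. x \<in> X \<Longrightarrow> \<sigma> x \<in> carrier A"
  shows "eval A \<sigma> t \<in> carrier A"
  using assms(1)
proof induction
  case (2 ts f)
  then have "set (map (eval A \<sigma>) ts) \<subseteq> carrier A" "length (map (eval A \<sigma>) ts) = arity \<Theta> f" by auto
  then show ?case using assms(2) unfolding is_alg_def eval.simps by blast
qed (simp add: assms(3))

text \<open>Evaluation in the term algebra is substitution, so this is the substitution
  lemma.\<close>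

lemma eval_eval_term_alg:
  "eval A \<sigma> (eval (term_alg \<Theta> X) \<tau> t) = eval A (\<lambda>x. eval A \<sigma> (\<tau> x)) t"
proof (induction t)
  case (Fun f ts)
  then have eq: "map (\<lambda>t. eval A \<sigma> (eval (term_alg \<Theta> X) \<tau> t)) ts =
      map (eval A (\<lambda>x. eval A \<sigma> (\<tau> x))) ts" by simp
  have "oper (term_alg \<Theta> X) = Fun" by (simp add: term_alg_def)
  then show ?case by (simp add: comp_def eq del: map_eq_conv)
qed simp

lemma eval_term_eq:
  assumes "term_eq \<Theta> X s t" and "in_variety A \<Theta>" and "\<And>x. x \<in> X \<Longrightarrow> \<sigma> x \<in> carrier A"
  shows "eval A \<sigma> s = eval A \<sigma> t"
  using assms(1)
proof induction
  case (term_ident l r \<tau>)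
  \<comment> \<open>\<open>\<sigma>\<close> is controlled on \<open>X\<close> only, but
    \<open>\<tau>\<close> sends every variable to a term over \<open>X\<close>, so the composed
    assignment has all its values in \<open>A\<close>, as the identities require.\<close>
  have "range (\<lambda>x. eval A \<sigma> (\<tau> x)) \<subseteq> carrier A"
    using term_ident(2) assms(2,3) eval_in_carrier[of _ \<Theta> X A \<sigma>] by (auto simp: in_variety_def)
  then show ?case using term_ident(1) assms(2)
    unfolding eval_eval_term_alg in_variety_def by blast
next
  case (term_cong ss f ts)
  then have "list_all2 (\<lambda>s t. eval A \<sigma> s = eval A \<sigma> t) ss ts"
    by (auto elim: list_all2_mono)
  then have "map (eval A \<sigma>) ss = map (eval A \<sigma>) ts"
    by (simp add: list_all2_conv_all_nth list_eq_iff_nth_eq)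
  then show ?case by (simp only: eval.simps)
qed auto

section \<open>Words as classes of terms\<close>

lemma mem_word_of [simp]: "s \<in> word_of \<Theta> X t \<longleftrightarrow> term_eq \<Theta> X t s"
  by (simp add: word_of_def)

lemma word_of_eqI: "term_eq \<Theta> X s t \<Longrightarrow> word_of \<Theta> X s = word_of \<Theta> X t"
  by (rule set_eqI) (simp, metis term_sym term_trans)

lemma term_eq_some_word_of:
  "t \<in> terms \<Theta> X \<Longrightarrow> term_eq \<Theta> X t (SOME s. s \<in> word_of \<Theta> X t)"
  using someI[of "\<lambda>s. s \<in> word_of \<Theta> X t" t] by (simp add: term_refl)

lemma carrier_W: "carrier (W \<Theta> X) = word_of \<Theta> X ` terms \<Theta> X"
  by (auto simp: W_def quotient_def word_of_def)

lemma var_in_W [simp]: "x \<in> X \<Longrightarrow> var \<Theta> X x \<in> carrier (W \<Theta> X)"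
  by (auto simp: carrier_W var_def intro: terms.intros)

lemma words_in_W:
  assumes "set ws \<subseteq> carrier (W \<Theta> X)"
  obtains ts where "ws = map (word_of \<Theta> X) ts" and "set ts \<subseteq> terms \<Theta> X"
proof -
  have "\<forall>w \<in> set ws. \<exists>t. t \<in> terms \<Theta> X \<and> w = word_of \<Theta> X t"
    using assms unfolding carrier_W by blast
  then obtain r where "\<forall>w \<in> set ws. r w \<in> terms \<Theta> X \<and> w = word_of \<Theta> X (r w)"
    unfolding bchoice_iff by blast
  then show thesis by (intro that[of "map r ws"]) (auto simp: map_idI)
qed

text \<open>The representatives picked by \<open>SOME\<close> differ from \<open>ts\<close> only up
  to \<open>term_eq\<close>, and \<open>term_cong\<close> carries this through \<open>f\<close>;
  hence the operation does not depend on the choice.\<close>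

lemma oper_W:
  assumes "length ts = arity \<Theta> f" and "set ts \<subseteq> terms \<Theta> X"
  shows "oper (W \<Theta> X) f (map (word_of \<Theta> X) ts) = word_of \<Theta> X (Fun f ts)"
proof -
  have "list_all2 (term_eq \<Theta> X) ts (map (\<lambda>t. SOME s. s \<in> word_of \<Theta> X t) ts)"
    using assms(2) by (auto simp: list_all2_conv_all_nth subset_iff intro!: term_eq_some_word_of simp del: mem_word_of)
  then have "term_eq \<Theta> X (Fun f ts) (Fun f (map (\<lambda>t. SOME s. s \<in> word_of \<Theta> X t) ts))"
    using assms(1) by (rule term_cong[rotated])
  from word_of_eqI[OF this] show ?thesis by (simp add: W_def comp_def)
qed

lemma is_alg_W: "is_alg \<Theta> (W \<Theta> X)"
  unfolding is_alg_def
proof (intro allI impI)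
  fix f ws assume "length ws = arity \<Theta> f" and "set ws \<subseteq> carrier (W \<Theta> X)"
  then show "oper (W \<Theta> X) f ws \<in> carrier (W \<Theta> X)"
    by (elim words_in_W) (auto simp: oper_W carrier_W intro!: imageI terms.intros)
qed

section \<open>Homomorphisms and freeness of \<open>W\<close>\<close>

lemma alg_hom_mem: "h \<in> alg_hom \<Theta> A B \<Longrightarrow> a \<in> carrier A \<Longrightarrow> h a \<in> carrier B"
  by (auto simp: alg_hom_def)

lemma alg_hom_extensional: "h \<in> alg_hom \<Theta> A B \<Longrightarrow> h \<in> extensional (carrier A)"
  by (auto simp: alg_hom_def PiE_def)

lemma alg_hom_oper:
  "h \<in> alg_hom \<Theta> A B \<Longrightarrow> length as = arity \<Theta> f \<Longrightarrow> set as \<subseteq> carrier A \<Longrightarrow>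
    h (oper A f as) = oper B f (map h as)"
  by (auto simp: alg_hom_def)

lemma alg_hom_compose:
  assumes "is_alg \<Theta> A" and g: "g \<in> alg_hom \<Theta> A B" and h: "h \<in> alg_hom \<Theta> B C"
  shows "compose (carrier A) h g \<in> alg_hom \<Theta> A C"
proof -
  have "compose (carrier A) h g (oper A f as) = oper C f (map (compose (carrier A) h g) as)"
    if "length as = arity \<Theta> f" "set as \<subseteq> carrier A" for f as
  proof -
    \<comment> \<open>Composition is restricted to \<open>carrier A\<close>, so closure of
      \<open>A\<close> under \<open>f\<close> is what makes its value here the intended one.\<close>
    have "oper A f as \<in> carrier A" using assms(1) that by (auto simp: is_alg_def)
    moreover have "set (map g as) \<subseteq> carrier B" using alg_hom_mem[OF g] that(2) by auto
    moreover have "map (\<lambda>a. h (g a)) as = map (compose (carrier A) h g) as"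
      using that(2) by (auto simp: compose_def)
    ultimately show ?thesis
      using alg_hom_oper[OF g that] alg_hom_oper[OF h, of "map g as" f] that(1)
      by (simp add: compose_eq comp_def del: map_eq_conv)
  qed
  then show ?thesis
    using alg_hom_mem[OF g] alg_hom_mem[OF h] by (auto simp: alg_hom_def compose_def)
qed

text \<open>By induction on \<open>t\<close>, a homomorphism on \<open>W(X)\<close> is evaluation
  under its own values at the variables; hence these determine it.\<close>

lemma alg_hom_word_of:
  assumes \<mu>: "\<mu> \<in> alg_hom \<Theta> (W \<Theta> X) A" and "t \<in> terms \<Theta> X"
  shows "\<mu> (word_of \<Theta> X t) = eval A (\<lambda>x. \<mu> (var \<Theta> X x)) t"
  using assms(2)
proof induction
  case (2 ts f)
  then have ts: "set ts \<subseteq> terms \<Theta> X" by auto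
  have "\<mu> (word_of \<Theta> X (Fun f ts)) = oper A f (map \<mu> (map (word_of \<Theta> X) ts))"
    using alg_hom_oper[OF \<mu>, of "map (word_of \<Theta> X) ts" f] 2(1) ts
    by (auto simp: oper_W carrier_W)
  also have "map \<mu> (map (word_of \<Theta> X) ts) = map (eval A (\<lambda>x. \<mu> (var \<Theta> X x))) ts"
    using 2 by simp
  finally show ?case by simp
qed (simp add: var_def)

lemma alg_hom_W_eqI:
  assumes "\<mu> \<in> alg_hom \<Theta> (W \<Theta> X) A" and "\<nu> \<in> alg_hom \<Theta> (W \<Theta> X) A"
    and "\<And>x. x \<in> X \<Longrightarrow> \<mu> (var \<Theta> X x) = \<nu> (var \<Theta> X x)"
  shows "\<mu> = \<nu>"
proof (rule extensionalityI[OF alg_hom_extensional alg_hom_extensional])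
  fix w assume "w \<in> carrier (W \<Theta> X)"
  then obtain t where "t \<in> terms \<Theta> X" "w = word_of \<Theta> X t" by (auto simp: carrier_W)
  with assms show "\<mu> w = \<nu> w" by (auto simp: alg_hom_word_of intro: eval_cong)
qed (use assms in auto)

text \<open>A word avoiding \<open>y\<close> has a representative term without \<open>y\<close>,
  whose value involves the remaining variables only.\<close>

lemma alg_hom_eq_if_avoids:
  assumes \<mu>: "\<mu> \<in> alg_hom \<Theta> (W \<Theta> X) A" and \<nu>: "\<nu> \<in> alg_hom \<Theta> (W \<Theta> X) A"
    and eq: "\<And>x. x \<in> X - {y} \<Longrightarrow> \<mu> (var \<Theta> X x) = \<nu> (var \<Theta> X x)"
    and w: "w \<in> carrier (W \<Theta> X)" "avoids \<Theta> X y w"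
  shows "\<mu> w = \<nu> w"
proof -
  obtain t where t: "t \<in> w" "t \<in> terms \<Theta> (X - {y})" using w by (auto simp: avoids_def)
  moreover obtain t' where "w = word_of \<Theta> X t'" using w by (auto simp: carrier_W)
  ultimately have "w = word_of \<Theta> X t" using word_of_eqI[of \<Theta> X t' t] by simp
  moreover have "t \<in> terms \<Theta> X" using t terms_mono by blast
  ultimately show ?thesis
    using eval_cong[OF t(2) eq] by (simp add: alg_hom_word_of[OF \<mu>] alg_hom_word_of[OF \<nu>])
qed

text \<open>Universal property of \<open>W(X)\<close>. A word is evaluated through a chosen
  representative; the identities of \<open>A\<close> make the choice immaterial by
  \<open>eval_term_eq\<close>.\<close>

lemma alg_hom_W_extend:
  assumes A: "in_variety A \<Theta>" and \<sigma>: "\<And>x. x \<in> X \<Longrightarrow> \<sigma> x \<in> carrier A"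
  obtains \<mu> where "\<mu> \<in> alg_hom \<Theta> (W \<Theta> X) A" and "\<And>x. x \<in> X \<Longrightarrow> \<mu> (var \<Theta> X x) = \<sigma> x"
proof -
  define \<mu> where "\<mu> = (\<lambda>w \<in> carrier (W \<Theta> X). eval A \<sigma> (SOME t. t \<in> w))"
  have \<mu>: "\<mu> (word_of \<Theta> X t) = eval A \<sigma> t" if "t \<in> terms \<Theta> X" for t
    using that eval_term_eq[OF term_eq_some_word_of[OF that] A \<sigma>] by (auto simp: \<mu>_def carrier_W)
  have alg: "is_alg \<Theta> A" using A by (simp add: in_variety_def)
  have "\<mu> (oper (W \<Theta> X) f ws) = oper A f (map \<mu> ws)"
    if len: "length ws = arity \<Theta> f" and ws: "set ws \<subseteq> carrier (W \<Theta> X)" for f ws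
  proof -
    obtain ts where ts: "ws = map (word_of \<Theta> X) ts" "set ts \<subseteq> terms \<Theta> X"
      using words_in_W[OF ws] .
    then have "map \<mu> ws = map (eval A \<sigma>) ts" using \<mu> by auto
    moreover have "Fun f ts \<in> terms \<Theta> X" using ts len by (auto intro: terms.intros)
    ultimately show ?thesis using ts(2) len unfolding ts(1) by (simp add: oper_W \<mu> del: map_map map_eq_conv)
  qed
  moreover have "\<mu> \<in> carrier (W \<Theta> X) \<rightarrow>\<^sub>E carrier A"
  proof (rule PiE_I)
    fix w assume "w \<in> carrier (W \<Theta> X)"
    then obtain t where "t \<in> terms \<Theta> X" "w = word_of \<Theta> X t" by (auto simp: carrier_W)
    with \<mu> alg \<sigma> show "\<mu> w \<in> carrier A" by (simp add: eval_in_carrier)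
  qed (simp add: \<mu>_def)
  ultimately have "\<mu> \<in> alg_hom \<Theta> (W \<Theta> X) A" by (simp add: alg_hom_def)
  moreover have "\<mu> (var \<Theta> X x) = \<sigma> x" if "x \<in> X" for x
    using that by (simp add: var_def \<mu> terms.intros)
  ultimately show thesis by (rule that)
qed

section \<open>The value homomorphism\<close>

text \<open>The interpretation of raw forms, before passing to classes. The sort takes part in the
  recursion because the body of \<open>Subst Y s u\<close> is evaluated in sort
  \<open>Y\<close>.\<close>

primrec form_val ::
  "('f, 'x) presentation \<Rightarrow> ('f, 'a) alg \<Rightarrow> ('f, 'x) form \<Rightarrow> 'x set \<Rightarrow> (('f, 'x) word \<Rightarrow> 'a) set" where
  "form_val \<Theta> H (Equ w w') X = equ (Hal \<Theta> H) X w w'"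
| "form_val \<Theta> H Zero X = zero (Hal \<Theta> H) X"
| "form_val \<Theta> H One X = one (Hal \<Theta> H) X"
| "form_val \<Theta> H (Neg u) X = neg (Hal \<Theta> H) X (form_val \<Theta> H u X)"
| "form_val \<Theta> H (Conj u v) X = meet (Hal \<Theta> H) X (form_val \<Theta> H u X) (form_val \<Theta> H v X)"
| "form_val \<Theta> H (Disj u v) X = join (Hal \<Theta> H) X (form_val \<Theta> H u X) (form_val \<Theta> H v X)"
| "form_val \<Theta> H (Exi x u) X = exi (Hal \<Theta> H) X x (form_val \<Theta> H u X)"
| "form_val \<Theta> H (Subst Y s u) X = subst (Hal \<Theta> H) Y X s (form_val \<Theta> H u Y)"

lemma form_val_subset: "form_val \<Theta> H u X \<subseteq> points \<Theta> H X"
  by (induction u arbitrary: X) (auto simp: Hal_def)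

section \<open>Points and the operations of \<open>Hal\<close>\<close>

lemma points_compose:
  "s \<in> alg_hom \<Theta> (W \<Theta> X) (W \<Theta> Y) \<Longrightarrow> \<mu> \<in> points \<Theta> H Y \<Longrightarrow>
    compose (carrier (W \<Theta> X)) \<mu> s \<in> points \<Theta> H X"
  unfolding points_def by (rule alg_hom_compose[OF is_alg_W])

lemma point_var_in_carrier: "\<mu> \<in> points \<Theta> H X \<Longrightarrow> x \<in> X \<Longrightarrow> \<mu> (var \<Theta> X x) \<in> carrier H"
  by (simp add: alg_hom_mem points_def)

text \<open>Freeness of \<open>W(X)\<close> permits changing a point at one variable alone; such
  points are the witnesses for commuting quantifiers and for \<open>subst_exi\<close>.\<close>

lemma point_update:
  assumes H: "in_variety H \<Theta>" and \<mu>: "\<mu> \<in> points \<Theta> H X" and a: "a \<in> carrier H"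
  obtains \<nu> where "\<nu> \<in> points \<Theta> H X"
    and "\<forall>z \<in> X. \<nu> (var \<Theta> X z) = (if z = y then a else \<mu> (var \<Theta> X z))"
proof (rule alg_hom_W_extend[OF H, of X "\<lambda>z. if z = y then a else \<mu> (var \<Theta> X z)"])
  show "(if z = y then a else \<mu> (var \<Theta> X z)) \<in> carrier H" if "z \<in> X" for z
    using a point_var_in_carrier[OF \<mu> that] by simp
qed (rule that, auto simp: points_def)

lemma points_eqI:
  "\<mu> \<in> points \<Theta> H X \<Longrightarrow> \<nu> \<in> points \<Theta> H X \<Longrightarrow>
    \<forall>x \<in> X. \<mu> (var \<Theta> X x) = \<nu> (var \<Theta> X x) \<Longrightarrow> \<mu> = \<nu>"
  by (auto simp: points_def intro: alg_hom_W_eqI)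

lemma Hal_exi_ge:
  "A \<subseteq> points \<Theta> H X \<Longrightarrow> A \<subseteq> exi (Hal \<Theta> H) X x A"
  by (auto simp: Hal_def)

lemma Hal_exi_iff:
  "\<mu> \<in> exi (Hal \<Theta> H) X x A \<longleftrightarrow>
    \<mu> \<in> points \<Theta> H X \<and> (\<exists>\<nu> \<in> A. \<forall>z \<in> X - {x}. \<mu> (var \<Theta> X z) = \<nu> (var \<Theta> X z))"
  by (simp add: Hal_def)

lemma Hal_subst_iff:
  "\<mu> \<in> subst (Hal \<Theta> H) X Y s A \<longleftrightarrow> \<mu> \<in> points \<Theta> H Y \<and> compose (carrier (W \<Theta> X)) \<mu> s \<in> A"
  by (simp add: Hal_def)

lemma Hal_exi_closed:
  assumes "\<mu> \<in> exi (Hal \<Theta> H) X x A" and "\<nu> \<in> points \<Theta> H X"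
    and "\<forall>z \<in> X - {x}. \<mu> (var \<Theta> X z) = \<nu> (var \<Theta> X z)"
  shows "\<nu> \<in> exi (Hal \<Theta> H) X x A"
  using assms unfolding Hal_exi_iff by metis

text \<open>A witness \<open>\<nu>\<close> for \<open>A\<close> agrees with \<open>\<mu>\<close> off
  \<open>x\<close>, and a quantified set is a cylinder in direction \<open>x\<close>, so it contains
  both points or neither.\<close>

lemma Hal_exi_meet:
  assumes A: "A \<subseteq> points \<Theta> H X"
  shows "exi (Hal \<Theta> H) X x (A \<inter> exi (Hal \<Theta> H) X x B) = exi (Hal \<Theta> H) X x A \<inter> exi (Hal \<Theta> H) X x B"
proof (intro subset_antisym subsetI)
  fix \<mu> assume "\<mu> \<in> exi (Hal \<Theta> H) X x (A \<inter> exi (Hal \<Theta> H) X x B)"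
  then obtain \<nu> where "\<mu> \<in> points \<Theta> H X" and "\<nu> \<in> A" and "\<nu> \<in> exi (Hal \<Theta> H) X x B"
    and eq: "\<forall>z \<in> X - {x}. \<mu> (var \<Theta> X z) = \<nu> (var \<Theta> X z)"
    unfolding Hal_exi_iff[of \<mu>] by blast
  moreover from eq have "\<forall>z \<in> X - {x}. \<nu> (var \<Theta> X z) = \<mu> (var \<Theta> X z)" by metis
  ultimately show "\<mu> \<in> exi (Hal \<Theta> H) X x A \<inter> exi (Hal \<Theta> H) X x B"
    using Hal_exi_closed[of \<nu>] Hal_exi_iff[of \<mu> \<Theta> H X x A] by blast
next
  fix \<mu> assume \<mu>: "\<mu> \<in> exi (Hal \<Theta> H) X x A \<inter> exi (Hal \<Theta> H) X x B"
  then obtain \<nu> where \<nu>: "\<nu> \<in> A" "\<forall>z \<in> X - {x}. \<mu> (var \<Theta> X z) = \<nu> (var \<Theta> X z)"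
    unfolding Int_iff Hal_exi_iff by blast
  then have "\<nu> \<in> exi (Hal \<Theta> H) X x B" using \<mu> A Hal_exi_closed[of \<mu>] by blast
  then show "\<mu> \<in> exi (Hal \<Theta> H) X x (A \<inter> exi (Hal \<Theta> H) X x B)"
    using \<mu> \<nu> Hal_exi_iff[of \<mu> \<Theta> H X x A]
      Hal_exi_iff[of \<mu> \<Theta> H X x "A \<inter> exi (Hal \<Theta> H) X x B"] by blast
qed

text \<open>One inclusion is enough: the other arises by exchanging \<open>x\<close> and
  \<open>y\<close>.\<close>

lemma Hal_exi_commute_subset:
  assumes H: "in_variety H \<Theta>" and xy: "x \<in> X" "y \<in> X" and A: "A \<subseteq> points \<Theta> H X"
  shows "exi (Hal \<Theta> H) X x (exi (Hal \<Theta> H) X y A) \<subseteq> exi (Hal \<Theta> H) X y (exi (Hal \<Theta> H) X x A)"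
proof
  fix \<mu> assume "\<mu> \<in> exi (Hal \<Theta> H) X x (exi (Hal \<Theta> H) X y A)"
  then obtain \<nu> where \<mu>: "\<mu> \<in> points \<Theta> H X" and \<nu>: "\<nu> \<in> exi (Hal \<Theta> H) X y A"
    and \<mu>\<nu>: "\<forall>z \<in> X - {x}. \<mu> (var \<Theta> X z) = \<nu> (var \<Theta> X z)"
    unfolding Hal_exi_iff[of \<mu>] by blast
  from \<nu> obtain \<rho> where \<rho>: "\<rho> \<in> A" and \<nu>\<rho>: "\<forall>z \<in> X - {y}. \<nu> (var \<Theta> X z) = \<rho> (var \<Theta> X z)"
    unfolding Hal_exi_iff by blast
  have "\<rho> (var \<Theta> X y) \<in> carrier H" using \<rho> A xy point_var_in_carrier[of \<rho> \<Theta>] by blast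
  \<comment> \<open>\<open>\<kappa>\<close> takes its value at \<open>y\<close> from
    \<open>\<rho>\<close> and the others from \<open>\<mu>\<close>, so it agrees with
    \<open>\<mu>\<close> off \<open>y\<close> and with \<open>\<rho>\<close> off
    \<open>x\<close>.\<close>
  then obtain \<kappa> where \<kappa>: "\<kappa> \<in> points \<Theta> H X"
    "\<forall>z \<in> X. \<kappa> (var \<Theta> X z) = (if z = y then \<rho> (var \<Theta> X y) else \<mu> (var \<Theta> X z))"
    by (rule point_update[OF H \<mu>])
  then have "\<forall>z \<in> X - {x}. \<kappa> (var \<Theta> X z) = \<rho> (var \<Theta> X z)"
    "\<forall>z \<in> X - {y}. \<mu> (var \<Theta> X z) = \<kappa> (var \<Theta> X z)"
    using \<mu>\<nu> \<nu>\<rho> by auto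
  then show "\<mu> \<in> exi (Hal \<Theta> H) X y (exi (Hal \<Theta> H) X x A)"
    using \<mu> \<kappa>(1) \<rho> Hal_exi_iff[of \<kappa> \<Theta> H X x A]
    unfolding Hal_exi_iff[of \<mu>] by blast
qed

lemma Hal_equ_oper:
  assumes "length ws = arity \<Theta> f" and "length ws' = arity \<Theta> f"
    and "set ws \<subseteq> carrier (W \<Theta> X)" and "set ws' \<subseteq> carrier (W \<Theta> X)"
    and "\<mu> \<in> points \<Theta> H X" and "\<forall>(w, w') \<in> set (zip ws ws'). \<mu> w = \<mu> w'"
  shows "\<mu> (oper (W \<Theta> X) f ws) = \<mu> (oper (W \<Theta> X) f ws')"
proof -
  have "map \<mu> ws = map \<mu> ws'"
    using assms(1,2,6) by (auto simp: list_eq_iff_nth_eq set_zip)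
  then show ?thesis
    using assms(1-4) alg_hom_oper[OF assms(5)[unfolded points_def], of _ f]
    by (simp del: map_eq_conv)
qed

text \<open>The folded conjunction is the premise \<open>p\<close> of the axiom
  \<open>equ_oper\<close>, which this reduces to \<open>Hal_equ_oper\<close>.\<close>

lemma form_val_Conj_Equ:
  "form_val \<Theta> H (foldr Conj (map2 Equ ws ws') One) X =
    {\<mu> \<in> points \<Theta> H X. \<forall>(w, w') \<in> set (zip ws ws'). \<mu> w = \<mu> w'}"
  by (induction ws ws' rule: list_induct2') (auto simp: Hal_def)

text \<open>Since \<open>s\<close> sends \<open>x\<close> to the variable \<open>y\<close> and the
  other variables to words without \<open>y\<close>, changing \<open>\<mu>\<close> at
  \<open>y\<close> changes the composite of \<open>\<mu>\<close> with \<open>s\<close> at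
  \<open>x\<close> only.\<close>

lemma Hal_subst_exi:
  assumes H: "in_variety H \<Theta>" and xy: "x \<in> X" "y \<in> Y" and A: "A \<subseteq> points \<Theta> H X"
    and s: "s \<in> alg_hom \<Theta> (W \<Theta> X) (W \<Theta> Y)" "s (var \<Theta> X x) = var \<Theta> Y y"
    and av: "\<forall>z \<in> X - {x}. avoids \<Theta> Y y (s (var \<Theta> X z))"
  shows "subst (Hal \<Theta> H) X Y s (exi (Hal \<Theta> H) X x A) = exi (Hal \<Theta> H) Y y (subst (Hal \<Theta> H) X Y s A)"
proof -
  have off: "\<mu> (s (var \<Theta> X z)) = \<nu> (s (var \<Theta> X z))"
    if "\<mu> \<in> points \<Theta> H Y" "\<nu> \<in> points \<Theta> H Y" "z \<in> X - {x}"
      "\<forall>z \<in> Y - {y}. \<mu> (var \<Theta> Y z) = \<nu> (var \<Theta> Y z)" for \<mu> \<nu> z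
  proof (rule alg_hom_eq_if_avoids[OF that(1,2)[unfolded points_def], where y = y])
    show "s (var \<Theta> X z) \<in> carrier (W \<Theta> Y)" using that(3) alg_hom_mem[OF s(1)] by simp
  qed (use that(3,4) av in blast)+
  show ?thesis
  proof (intro subset_antisym subsetI)
    fix \<mu> assume "\<mu> \<in> subst (Hal \<Theta> H) X Y s (exi (Hal \<Theta> H) X x A)"
    then obtain \<rho> where \<mu>: "\<mu> \<in> points \<Theta> H Y" and \<rho>: "\<rho> \<in> A"
      and eq: "\<forall>z \<in> X - {x}. compose (carrier (W \<Theta> X)) \<mu> s (var \<Theta> X z) = \<rho> (var \<Theta> X z)"
      unfolding Hal_subst_iff Hal_exi_iff by blast
    have "\<rho> (var \<Theta> X x) \<in> carrier H" using \<rho> A xy point_var_in_carrier[of \<rho> \<Theta>] by blast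
    \<comment> \<open>\<open>\<nu>\<close> is \<open>\<mu>\<close> with the value at
      \<open>y\<close> replaced by that of \<open>\<rho>\<close> at \<open>x\<close>, which makes
      its composite with \<open>s\<close> equal to \<open>\<rho>\<close>.\<close>
    then obtain \<nu> where \<nu>: "\<nu> \<in> points \<Theta> H Y"
      "\<forall>z \<in> Y. \<nu> (var \<Theta> Y z) = (if z = y then \<rho> (var \<Theta> X x) else \<mu> (var \<Theta> Y z))"
      by (rule point_update[OF H \<mu>])
    have "compose (carrier (W \<Theta> X)) \<nu> s = \<rho>"
    proof (rule points_eqI[OF points_compose[OF s(1) \<nu>(1)]])
      show "\<rho> \<in> points \<Theta> H X" using \<rho> A by auto
      show "\<forall>z \<in> X. compose (carrier (W \<Theta> X)) \<nu> s (var \<Theta> X z) = \<rho> (var \<Theta> X z)"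
      proof
        fix z assume z: "z \<in> X"
        show "compose (carrier (W \<Theta> X)) \<nu> s (var \<Theta> X z) = \<rho> (var \<Theta> X z)"
          using off[OF \<mu> \<nu>(1), of z] z eq \<nu>(2) s(2) xy
          by (cases "z = x") (auto simp: compose_eq)
      qed
    qed
    then show "\<mu> \<in> exi (Hal \<Theta> H) Y y (subst (Hal \<Theta> H) X Y s A)"
      unfolding Hal_exi_iff using \<mu> \<nu> \<rho> by (intro conjI bexI[of _ \<nu>]) (auto simp: Hal_subst_iff)
  next
    fix \<mu> assume "\<mu> \<in> exi (Hal \<Theta> H) Y y (subst (Hal \<Theta> H) X Y s A)"
    then obtain \<nu> where \<mu>: "\<mu> \<in> points \<Theta> H Y" and "\<nu> \<in> subst (Hal \<Theta> H) X Y s A"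
      and "\<forall>z \<in> Y - {y}. \<mu> (var \<Theta> Y z) = \<nu> (var \<Theta> Y z)"
      unfolding Hal_exi_iff by blast
    moreover from this have \<nu>: "\<nu> \<in> points \<Theta> H Y" and "compose (carrier (W \<Theta> X)) \<nu> s \<in> A"
      by (simp_all add: Hal_subst_iff)
    \<comment> \<open>The witness is the composite of \<open>\<nu>\<close> with \<open>s\<close>; by
      \<open>off\<close> it agrees with that of \<open>\<mu>\<close> off \<open>x\<close>.\<close>
    ultimately show "\<mu> \<in> subst (Hal \<Theta> H) X Y s (exi (Hal \<Theta> H) X x A)"
      unfolding Hal_subst_iff Hal_exi_iff using off[OF \<mu> \<nu>] points_compose[OF s(1) \<mu>]
      by (intro conjI bexI[of _ "compose (carrier (W \<Theta> X)) \<nu> s"]) (auto simp: compose_eq)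
  qed
qed

text \<open>\<open>Hal\<close> obeys the Halmos axioms. They are taken as instances in
  \<open>form_alg\<close>, the form in which they generate \<open>form_eq\<close>.\<close>

lemma form_val_axiom:
  assumes H: "in_variety H \<Theta>" and "halmos_axiom \<Theta> (form_alg \<Theta>) X u v"
  shows "form_val \<Theta> H u X = form_val \<Theta> H v X"
  using assms(2)
proof induction
  case (exi_ge X x a)
  then show ?case
    using Hal_exi_ge[OF form_val_subset, of \<Theta> H a X x] by (simp add: Hal_def form_alg_def Int_absorb2)
next
  case (exi_meet X x a b)
  then show ?case
    using Hal_exi_meet[OF form_val_subset[of \<Theta> H a X]] by (simp add: Hal_def form_alg_def)
next
  case (exi_commute X x y a)
  then show ?case
    using Hal_exi_commute_subset[OF H _ _ form_val_subset] by (simp add: form_alg_def subset_antisym)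
next
  case (equ_oper X ws f ws' p)
  then have "form_val \<Theta> H p X = {\<mu> \<in> points \<Theta> H X. \<forall>(w, w') \<in> set (zip ws ws'). \<mu> w = \<mu> w'}"
    by (simp add: form_alg_def form_val_Conj_Equ)
  then show ?case
    using equ_oper Hal_equ_oper[of ws \<Theta> f ws' X _ H] by (auto simp: form_alg_def Hal_def)
next
  case (subst_id X a)
  have "compose (carrier (W \<Theta> X)) \<mu> (\<lambda>w \<in> carrier (W \<Theta> X). w) = \<mu>" if "\<mu> \<in> points \<Theta> H X" for \<mu>
    using that by (intro compose_Id[OF _ alg_hom_extensional]) (auto simp: points_def alg_hom_mem)
  with subst_id show ?case
    using form_val_subset[of \<Theta> H a X] by (auto simp: form_alg_def Hal_def)
next
  case (subst_comp X Y Z s s' a)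
  \<comment> \<open>Restricted composition is associative here because \<open>s\<close> maps into
    \<open>W(Y)\<close>, where the inner restriction has no effect.\<close>
  have "compose (carrier (W \<Theta> X)) (compose (carrier (W \<Theta> Y)) \<mu> s') s =
    compose (carrier (W \<Theta> X)) \<mu> (compose (carrier (W \<Theta> X)) s' s)" if "\<mu> \<in> points \<Theta> H Z" for \<mu>
    using alg_hom_mem[OF subst_comp(4)] by (auto simp: compose_def)
  with subst_comp show ?case
    using points_compose[OF subst_comp(5), of _ H]
    by (auto simp add: form_alg_def set_eq_iff Hal_subst_iff)
next
  case (subst_exi_irrelevant X Y x a s s')
  have "compose (carrier (W \<Theta> X)) \<mu> s (var \<Theta> X z) = compose (carrier (W \<Theta> X)) \<mu> s' (var \<Theta> X z)"
    if "\<mu> \<in> points \<Theta> H Y" and "z \<in> X - {x}" for \<mu> z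
    using that subst_exi_irrelevant by (simp add: compose_eq)
  with subst_exi_irrelevant show ?case
    by (simp add: form_alg_def set_eq_iff Hal_subst_iff Hal_exi_iff points_compose cong: conj_cong)
next
  case (subst_exi X Y x y a s)
  then show ?case
    using Hal_subst_exi[OF H _ _ form_val_subset] by (simp add: form_alg_def)
next
  case (subst_equ X Y s w w')
  then show ?case
    by (auto simp: form_alg_def Hal_def points_compose compose_eq)
next
  case (equ_replace X x a w w' s s' p)
  \<comment> \<open>On variables \<open>s\<close> and \<open>s'\<close> differ at most at
    \<open>x\<close>, where \<open>\<mu> w = \<mu> w'\<close> removes the difference; so both
    composites are the same point.\<close>
  have "compose (carrier (W \<Theta> X)) \<mu> s = compose (carrier (W \<Theta> X)) \<mu> s'"
    if \<mu>: "\<mu> \<in> points \<Theta> H X" and "\<mu> w = \<mu> w'" for \<mu>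
  proof (rule points_eqI[OF points_compose points_compose])
    show "\<forall>z \<in> X. compose (carrier (W \<Theta> X)) \<mu> s (var \<Theta> X z) = compose (carrier (W \<Theta> X)) \<mu> s' (var \<Theta> X z)"
    proof
      fix z assume "z \<in> X"
      then show "compose (carrier (W \<Theta> X)) \<mu> s (var \<Theta> X z) = compose (carrier (W \<Theta> X)) \<mu> s' (var \<Theta> X z)"
        using equ_replace that by (cases "z = x") (auto simp: compose_eq)
    qed
  qed (use equ_replace \<mu> in auto)
  with equ_replace show ?case by (auto simp: form_alg_def Hal_def)
next
  case (subst_one X Y s)
  then show ?case by (auto simp: form_alg_def Hal_def points_compose)
next
  case (subst_neg X Y s a)
  then show ?case by (auto simp: form_alg_def Hal_def points_compose)
\<comment> \<open>The remaining axioms are elementary set identities; \<open>meet_one\<close> and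
  \<open>join_neg\<close> rely on values being sets of points.\<close>
qed (use form_val_subset in \<open>fastforce simp: Hal_def form_alg_def\<close>)+

text \<open>Values are compositional, so soundness of the axioms extends to the generated congruence
  and \<open>form_val\<close> descends to formulas.\<close>

lemma form_val_form_eq:
  assumes H: "in_variety H \<Theta>" and "form_eq \<Theta> X u v"
  shows "form_val \<Theta> H u X = form_val \<Theta> H v X"
  using assms(2) by induction (simp_all add: form_val_axiom[OF H])

section \<open>The quotient \<open>Phi\<close> and the homomorphism \<open>Val\<close>\<close>

lemma mem_formula_of [simp]: "v \<in> formula_of \<Theta> X u \<longleftrightarrow> form_eq \<Theta> X u v"
  by (simp add: formula_of_def)

lemma formula_of_eqI: "form_eq \<Theta> X u v \<Longrightarrow> formula_of \<Theta> X u = formula_of \<Theta> X v"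
  by (rule set_eqI) (simp, metis form_sym form_trans)

lemma form_eq_some_formula_of:
  "is_form \<Theta> X u \<Longrightarrow> form_eq \<Theta> X (SOME v. v \<in> formula_of \<Theta> X u) u"
  using someI[of "\<lambda>v. v \<in> formula_of \<Theta> X u" u] by (simp add: form_refl form_sym)

lemma sorts_Phi: "sorts (Phi \<Theta>) X = formula_of \<Theta> X ` {u. is_form \<Theta> X u}"
  by (auto simp: Phi_def Let_def form_alg_def quotient_def formula_of_def)

text \<open>Well-definedness of the operations of \<open>Phi\<close>: as \<open>form_eq\<close> is a
  congruence, the chosen representatives may be replaced by given ones.\<close>

lemma Phi_formula_of:
  "zero (Phi \<Theta>) X = formula_of \<Theta> X Zero"
  "one (Phi \<Theta>) X = formula_of \<Theta> X One"
  "equ (Phi \<Theta>) X w w' = formula_of \<Theta> X (Equ w w')"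
  "is_form \<Theta> X u \<Longrightarrow> neg (Phi \<Theta>) X (formula_of \<Theta> X u) = formula_of \<Theta> X (Neg u)"
  "is_form \<Theta> X u \<Longrightarrow> is_form \<Theta> X v \<Longrightarrow>
    meet (Phi \<Theta>) X (formula_of \<Theta> X u) (formula_of \<Theta> X v) = formula_of \<Theta> X (Conj u v)"
  "is_form \<Theta> X u \<Longrightarrow> is_form \<Theta> X v \<Longrightarrow>
    join (Phi \<Theta>) X (formula_of \<Theta> X u) (formula_of \<Theta> X v) = formula_of \<Theta> X (Disj u v)"
  "is_form \<Theta> X u \<Longrightarrow> x \<in> X \<Longrightarrow>
    exi (Phi \<Theta>) X x (formula_of \<Theta> X u) = formula_of \<Theta> X (Exi x u)"
  "is_form \<Theta> X u \<Longrightarrow> finite X \<Longrightarrow> s \<in> alg_hom \<Theta> (W \<Theta> X) (W \<Theta> Y) \<Longrightarrow>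
    subst (Phi \<Theta>) X Y s (formula_of \<Theta> X u) = formula_of \<Theta> Y (Subst X s u)"
  by (simp_all add: Phi_def Let_def form_alg_def del: mem_formula_of)
    (intro formula_of_eqI form_neg form_conj form_disj form_exi form_subst
      form_eq_some_formula_of; assumption)+

text \<open>Uniqueness half of freeness: forms are built by the operations alone, so induction on
  \<open>is_form\<close> forces the value. The sort varies in the induction because of
  \<open>Subst\<close>, whose formation rule makes the source sort finite.\<close>

lemma msalg_hom_formula_of:
  assumes "h \<in> msalg_hom \<Theta> (Phi \<Theta>) (Hal \<Theta> H)" and "is_form \<Theta> X u" and "finite X"
  shows "h X (formula_of \<Theta> X u) = form_val \<Theta> H u X"
  using assms(2,3)
proof induction
  case (8 X s Y u)
  have "h Y (subst (Phi \<Theta>) X Y s (formula_of \<Theta> X u)) = subst (Hal \<Theta> H) X Y s (h X (formula_of \<Theta> X u))"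
    using assms(1) 8 by (simp add: msalg_hom_def sorts_Phi)
  with 8 show ?case by (simp add: Phi_formula_of)
qed (use assms(1) in \<open>auto simp: msalg_hom_def sorts_Phi Phi_formula_of[symmetric]\<close>)

text \<open>Existence half, by evaluating a representative. \<open>h\<close> is restricted twice
  because \<open>msalg_hom\<close> consists of extensional families of extensional maps.\<close>

lemma ex_msalg_hom:
  assumes "in_variety H \<Theta>"
  shows "\<exists>h. h \<in> msalg_hom \<Theta> (Phi \<Theta>) (Hal \<Theta> H)"
proof -
  define h where "h = (\<lambda>X \<in> {X. finite X}. \<lambda>U \<in> sorts (Phi \<Theta>) X.
    form_val \<Theta> H (SOME u. u \<in> U) X)"
  have h: "h X (formula_of \<Theta> X u) = form_val \<Theta> H u X" if "finite X" "is_form \<Theta> X u" for X u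
    using that form_val_form_eq[OF assms form_eq_some_formula_of] by (auto simp: h_def sorts_Phi)
  have "h \<in> (\<Pi>\<^sub>E X \<in> {X. finite X}. sorts (Phi \<Theta>) X \<rightarrow>\<^sub>E sorts (Hal \<Theta> H) X)"
    using form_val_subset by (fastforce simp: h_def Hal_def)
  then have "h \<in> msalg_hom \<Theta> (Phi \<Theta>) (Hal \<Theta> H)"
    by (auto simp: msalg_hom_def sorts_Phi Phi_formula_of h is_form.intros)
  then show ?thesis by blast
qed

text \<open>Existence and uniqueness resolve the definite description in \<open>Val\<close>.\<close>

lemma Val_formula_of:
  assumes "in_variety H \<Theta>" and "finite X" and "is_form \<Theta> X u"
  shows "Val \<Theta> H X (formula_of \<Theta> X u) = form_val \<Theta> H u X"
proof -
  obtain h where h: "h \<in> msalg_hom \<Theta> (Phi \<Theta>) (Hal \<Theta> H)" using ex_msalg_hom[OF assms(1)] ..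
  have "h' = h" if h': "h' \<in> msalg_hom \<Theta> (Phi \<Theta>) (Hal \<Theta> H)" for h'
  proof -
    \<comment> \<open>Off the finite sets, and off the formulas in each sort, both families are
      \<open>undefined\<close>, so agreement on formulas gives equality.\<close>
    have PiE: "g \<in> (\<Pi>\<^sub>E X \<in> {X. finite X}. sorts (Phi \<Theta>) X \<rightarrow>\<^sub>E sorts (Hal \<Theta> H) X)"
      if "g \<in> msalg_hom \<Theta> (Phi \<Theta>) (Hal \<Theta> H)" for g
      using that by (simp add: msalg_hom_def)
    have "h' X = h X" if X: "finite X" for X
    proof (rule PiE_ext)
      show "h' X \<in> sorts (Phi \<Theta>) X \<rightarrow>\<^sub>E sorts (Hal \<Theta> H) X"
        "h X \<in> sorts (Phi \<Theta>) X \<rightarrow>\<^sub>E sorts (Hal \<Theta> H) X"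
        using PiE_mem[OF PiE] h h' X by auto
      show "h' X U = h X U" if "U \<in> sorts (Phi \<Theta>) X" for U
        using that h h' X by (auto simp: sorts_Phi msalg_hom_formula_of)
    qed
    then show ?thesis using PiE_ext[OF PiE[OF h'] PiE[OF h]] by simp
  qed
  then have "Val \<Theta> H = h" unfolding Val_def
    using h the_equality[of "\<lambda>h. h \<in> msalg_hom \<Theta> (Phi \<Theta>) (Hal \<Theta> H)" h] by blast
  then show ?thesis using msalg_hom_formula_of[OF h assms(3,2)] by simp
qed

section \<open>Logical kernels\<close>

lemma LKer_subset_Phi: "LKer \<Theta> H X \<mu> \<subseteq> sorts (Phi \<Theta>) X"
  by (auto simp: LKer_def)

lemma formula_of_in_LKer_iff:
  assumes "in_variety H \<Theta>" and "finite X" and "is_form \<Theta> X u"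
  shows "formula_of \<Theta> X u \<in> LKer \<Theta> H X \<mu> \<longleftrightarrow> \<mu> \<in> form_val \<Theta> H u X"
  using assms by (auto simp: LKer_def Val_formula_of sorts_Phi)

text \<open>\<open>Zero\<close> has the empty value, so kernels are proper; this later rules out an
  empty set of points.\<close>

lemma Zero_notin_LKer:
  assumes "in_variety H \<Theta>" and "finite X"
  shows "formula_of \<Theta> X Zero \<notin> LKer \<Theta> H X \<mu>"
  using assms by (simp add: formula_of_in_LKer_iff is_form.intros Hal_def)

lemma Neg_in_LKer_iff:
  assumes "in_variety H \<Theta>" and "finite X" and "is_form \<Theta> X u" and "\<mu> \<in> points \<Theta> H X"
  shows "formula_of \<Theta> X (Neg u) \<in> LKer \<Theta> H X \<mu> \<longleftrightarrow> formula_of \<Theta> X u \<notin> LKer \<Theta> H X \<mu>"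
  using assms by (simp add: formula_of_in_LKer_iff is_form.intros Hal_def)

text \<open>Kernels are maximal: the negation of a formula missing from the smaller kernel lies in
  it, hence in the larger one, which therefore omits the formula as well.\<close>

lemma LKer_eqI:
  assumes "in_variety H1 \<Theta>" and "in_variety H2 \<Theta>" and "finite X"
    and "\<mu> \<in> points \<Theta> H1 X" and "\<nu> \<in> points \<Theta> H2 X"
    and sub: "LKer \<Theta> H1 X \<mu> \<subseteq> LKer \<Theta> H2 X \<nu>"
  shows "LKer \<Theta> H1 X \<mu> = LKer \<Theta> H2 X \<nu>"
proof (rule subset_antisym[OF sub subsetI])
  fix U assume U: "U \<in> LKer \<Theta> H2 X \<nu>"
  then obtain u where u: "is_form \<Theta> X u" "U = formula_of \<Theta> X u"
    using LKer_subset_Phi[of \<Theta> H2 X \<nu>] unfolding sorts_Phi by blast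
  then have "formula_of \<Theta> X (Neg u) \<notin> LKer \<Theta> H2 X \<nu>"
    using U Neg_in_LKer_iff[OF assms(2,3) u(1) assms(5)] by simp
  then show "U \<in> LKer \<Theta> H1 X \<mu>"
    using subsetD[OF sub, of "formula_of \<Theta> X (Neg u)"]
      Neg_in_LKer_iff[OF assms(1,3) u(1) assms(4)] u(2) by blast
qed

text \<open>The right-hand side sees the algebra only through the set of kernels of its points,
  which is what isotypy compares.\<close>

lemma theory_of_points_of:
  "theory_of \<Theta> H X (points_of \<Theta> H X T) =
    sorts (Phi \<Theta>) X \<inter> \<Inter> {K \<in> LKer \<Theta> H X ` points \<Theta> H X. T \<subseteq> K}"
  by (auto simp: theory_of_def points_of_def)

text \<open>\<open>\<mu>\<close> is itself one of the points over which the intersection runs, so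
  the closure cannot exceed its kernel.\<close>

lemma theory_of_points_of_LKer:
  "\<mu> \<in> points \<Theta> H X \<Longrightarrow> theory_of \<Theta> H X (points_of \<Theta> H X (LKer \<Theta> H X \<mu>)) = LKer \<Theta> H X \<mu>"
  using LKer_subset_Phi[of \<Theta> H X \<mu>] unfolding theory_of_points_of by blast

lemma LG_isotypic_iff:
  "LG_isotypic \<Theta> H1 H2 \<longleftrightarrow>
    (\<forall>X. finite X \<longrightarrow> LKer \<Theta> H1 X ` points \<Theta> H1 X = LKer \<Theta> H2 X ` points \<Theta> H2 X)"
  unfolding LG_isotypic_def set_eq_subset image_subset_iff image_iff by blast

lemma LG_equivalent_sym: "LG_equivalent \<Theta> H1 H2 \<Longrightarrow> LG_equivalent \<Theta> H2 H1"
  by (simp add: LG_equivalent_def)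

lemma LG_equivalent_LKer_subset:
  assumes H: "in_variety H1 \<Theta>" "in_variety H2 \<Theta>" and "LG_equivalent \<Theta> H1 H2" and X: "finite X"
  shows "LKer \<Theta> H1 X ` points \<Theta> H1 X \<subseteq> LKer \<Theta> H2 X ` points \<Theta> H2 X"
proof
  fix T assume "T \<in> LKer \<Theta> H1 X ` points \<Theta> H1 X"
  then obtain \<mu> where \<mu>: "\<mu> \<in> points \<Theta> H1 X" "T = LKer \<Theta> H1 X \<mu>" by auto
  then have "theory_of \<Theta> H2 X (points_of \<Theta> H2 X T) = T"
    using assms(3) X theory_of_points_of_LKer[OF \<mu>(1)] LKer_subset_Phi[of \<Theta> H1 X \<mu>]
    by (simp add: LG_equivalent_def)
  then have "formula_of \<Theta> X Zero \<notin> theory_of \<Theta> H2 X (points_of \<Theta> H2 X T)"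
    using \<mu> H(1) X by (simp add: Zero_notin_LKer)
  \<comment> \<open>With no such point the closure would be an empty intersection, that is all of
    \<open>\<Phi>(X)\<close>, and would contain \<open>Zero\<close>.\<close>
  then have "points_of \<Theta> H2 X T \<noteq> {}"
    by (auto simp: theory_of_def sorts_Phi intro: is_form.intros)
  then obtain \<nu> where "\<nu> \<in> points \<Theta> H2 X" "T \<subseteq> LKer \<Theta> H2 X \<nu>" by (auto simp: points_of_def)
  then show "T \<in> LKer \<Theta> H2 X ` points \<Theta> H2 X" using LKer_eqI[OF H X] \<mu> by blast
qed

theorem theorem3p9:
  fixes \<Theta> :: "('f, 'x) presentation"
    and H1 :: "('f, 'a) alg" and H2 :: "('f, 'b) alg"
  assumes "infinite (UNIV :: 'x set)"
    and "presents_variety \<Theta>"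
    and "in_variety H1 \<Theta>" and "in_variety H2 \<Theta>"
  shows "LG_equivalent \<Theta> H1 H2 \<longleftrightarrow> LG_isotypic \<Theta> H1 H2"
proof
  assume "LG_equivalent \<Theta> H1 H2"
  then show "LG_isotypic \<Theta> H1 H2"
    unfolding LG_isotypic_iff
    using LG_equivalent_LKer_subset assms(3,4) LG_equivalent_sym by (metis subset_antisym)
next
  assume "LG_isotypic \<Theta> H1 H2"
  then show "LG_equivalent \<Theta> H1 H2"
    by (simp add: LG_isotypic_iff LG_equivalent_def theory_of_points_of)
qed

end
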